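(* Let $d\ge 1$ be an integer. For every nearly neighbourly family $\mathscr{F}$ of $d$-simplices in $\mathbb{R}^d$, $$|\mathscr{F}|\le 2^{d+1}-2.$$
   Context: A $d$-simplex in $\mathbb{R}^d$ is the convex hull of $d+1$ affinely independent points; its facets are its $(d-1)$-dimensional faces (the convex hulls of $d$ of its vertices). A family (set) of $d$-simplices in $\mathbb{R}^d$ is nearly neighbourly if every two distinct members $\sigma,\tau$ are separated by a hyperplane that contains a facet of each; that is, there is a hyperplane $H$ containing a facet of $\sigma$ and a facet of $\tau$ such that $\sigma$ and $\tau$ lie in different closed halfspaces bounded by $H$. *)

theory Defs
  imports "HOL-Analysis.Analysis"
begin

definition facet_separated :: "'a::euclidean_space set \<Rightarrow> 'a set \<Rightarrow> bool" where
  "facet_separated \<sigma> \<tau> \<longleftrightarrow>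
     (\<exists>a b. a \<noteq> 0 \<and>
        (\<exists>f. f facet_of \<sigma> \<and> f \<subseteq> {x. a \<bullet> x = b}) \<and>
        (\<exists>g. g facet_of \<tau> \<and> g \<subseteq> {x. a \<bullet> x = b}) \<and>
        \<sigma> \<subseteq> {x. a \<bullet> x \<le> b} \<and> \<tau> \<subseteq> {x. a \<bullet> x \<ge> b})"

(* Fixing which simplex lies on which side loses nothing: replace (a, b) by (-a, -b). *)
lemma facet_separated_sym: "facet_separated \<sigma> \<tau> \<longleftrightarrow> facet_separated \<tau> \<sigma>"
proof -
  have *: "facet_separated \<tau> \<sigma>" if h: "facet_separated \<sigma> \<tau>" for \<sigma> \<tau> :: "'a set"
  proof -
    obtain a b f g where "a \<noteq> 0" "f facet_of \<sigma>" "f \<subseteq> {x. a \<bullet> x = b}"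
      "g facet_of \<tau>" "g \<subseteq> {x. a \<bullet> x = b}"
      "\<sigma> \<subseteq> {x. a \<bullet> x \<le> b}" "\<tau> \<subseteq> {x. a \<bullet> x \<ge> b}"
      using h unfolding facet_separated_def by blast
    then show ?thesis
      unfolding facet_separated_def
      by (intro exI[of _ "-a"] exI[of _ "-b"]) auto
  qed
  show ?thesis using * by blast
qed

definition nearly_neighbourly :: "'a::euclidean_space set set \<Rightarrow> bool" where
  "nearly_neighbourly F \<longleftrightarrow> (\<forall>\<sigma>\<in>F. \<forall>\<tau>\<in>F. \<sigma> \<noteq> \<tau> \<longrightarrow> facet_separated \<sigma> \<tau>)"

end

theory Submission
  imports Defs
begin

text \<open>
  Let \<open>m = d + 1\<close> and let \<open>V\<close> be the finite set of all hyperplanes spanned by facets of a finite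
  nearly neighbourly family. Orient every hyperplane in \<open>V\<close>. A simplex \<open>\<sigma>\<close> lies on a definite side
  of each of its \<open>m\<close> own facet hyperplanes, and this prescribes \<open>m\<close> coordinates of a sign vector on
  \<open>V\<close>; the sign vectors that agree with it form a subcube of density \<open>2 ^ (-m)\<close>. Two distinct simplices
  lie on opposite sides of a common facet hyperplane, so their subcubes are disjoint. Counting gives
  at most \<open>2 ^ m\<close> members, and every sign vector outside all subcubes improves on this.

  Such vectors come from infinity: a direction \<open>u \<noteq> 0\<close> has a sign with respect to each hyperplane, and
  no simplex contains its sign vector in its subcube, because simplices are bounded
  (\<open>no_recession_direction\<close>). Fix one simplex \<open>\<kappa>\<close>. The \<open>2 ^ m\<close> sign patterns on its facet hyperplanes cut
  the cube into fibres. Apart from the pattern of \<open>\<kappa>\<close> and its opposite, every pattern is realised by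
  some direction (\<open>direction_with_signs\<close>), so \<open>2 ^ m - 2\<close> fibres contain an uncovered vector.

  One uncovered vector forces many. Every other simplex shares a facet hyperplane with \<open>\<kappa>\<close>, so its
  subcube meets a fibre either in the empty set or in a subcube of codimension at most \<open>2m - 1\<close>.
  The part of the fibre that is covered, and therefore also the part that is not, has a density
  that is a multiple of \<open>2 ^ (-(2m-1))\<close> (\<open>uncovered_part_of_subcube\<close>). Hence the uncovered vectors have
  density at least \<open>(2 ^ m - 2) / 2 ^ (2m-1)\<close>, and for a family of \<open>N\<close> simplices

    \<open>N \<le> 2 ^ m - (2 ^ m - 2) / 2 ^ (m-1) = 2 ^ m - 2 + 1 / 2 ^ (m-2)\<close>.

  For \<open>d \<ge> 2\<close> the last term is below \<open>1\<close>, and integrality gives the bound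
  (\<open>card_clashing_subcubes_le\<close>). For \<open>d = 1\<close> the same estimate only yields \<open>3\<close>, and the combinatorial
  part cannot do better: the three patterns \<open>+ - *\<close>, \<open>* + -\<close>, \<open>- * +\<close> give disjoint subcubes that leave
  out just \<open>+ + +\<close> and \<open>- - -\<close>. There the order of the line excludes three segments
  (\<open>card_nearly_neighbourly_line_le\<close>).
\<close>

section \<open>Disjoint subcubes of the discrete cube\<close>

text \<open>
  A sign vector on \<open>V\<close> is represented by the set \<open>S \<subseteq> V\<close> of its positive coordinates; \<open>K\<close> is the set of
  prescribed coordinates and \<open>P\<close> the positive ones among them.
\<close>

definition subcube :: "'h set \<Rightarrow> 'h set \<Rightarrow> 'h set \<Rightarrow> 'h set set" where
  "subcube V K P = {S \<in> Pow V. S \<inter> K = P}"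

lemma card_subcube:
  assumes "finite V" "K \<subseteq> V" "P \<subseteq> K"
  shows "2 ^ card K * card (subcube V K P) = 2 ^ card V"
proof -
  have "bij_betw (\<lambda>T. T \<union> P) (Pow (V - K)) (subcube V K P)"
    by (rule bij_betw_byWitness[where f' = "\<lambda>S. S - K"])
       (use assms in \<open>auto simp: subcube_def\<close>)
  then have "card (subcube V K P) = 2 ^ card (V - K)"
    using assms by (metis bij_betw_same_card card_Pow finite_Diff)
  moreover have "card K + card (V - K) = card V"
    using assms by (metis card_Diff_subset card_mono finite_subset le_add_diff_inverse)
  ultimately show ?thesis
    by (simp flip: power_add)
qed

lemma subcube_Int_eq:
  assumes "P \<subseteq> K" "P' \<subseteq> K'"
  shows "subcube V K P \<inter> subcube V K' P' =
    (if P \<inter> K' = P' \<inter> K then subcube V (K \<union> K') (P \<union> P') else {})"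
proof -
  have "S \<inter> K = P \<and> S \<inter> K' = P' \<longleftrightarrow>
      P \<inter> K' = P' \<inter> K \<and> S \<inter> (K \<union> K') = P \<union> P'" for S
  proof
    assume "S \<inter> K = P \<and> S \<inter> K' = P'"
    then show "P \<inter> K' = P' \<inter> K \<and> S \<inter> (K \<union> K') = P \<union> P'"
      by blast
  next
    assume *: "P \<inter> K' = P' \<inter> K \<and> S \<inter> (K \<union> K') = P \<union> P'"
    have "S \<inter> K = (P \<union> P') \<inter> K" "S \<inter> K' = (P \<union> P') \<inter> K'"
      using * by blast+
    with * assms show "S \<inter> K = P \<and> S \<inter> K' = P'"
      by blast
  qed
  then have "S \<in> subcube V K P \<inter> subcube V K' P' \<longleftrightarrow>
      P \<inter> K' = P' \<inter> K \<and> S \<in> subcube V (K \<union> K') (P \<union> P')" for S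
    unfolding subcube_def by blast
  then show ?thesis
    by (intro set_eqI) (simp del: Int_iff)
qed

text \<open>
  A common coordinate saves one prescription in the intersection. The divisibility says that the
  intersection has density \<open>n / 2 ^ (k+k'-1)\<close> for an integer \<open>n\<close>, where \<open>k\<close> and \<open>k'\<close> count the prescribed
  coordinates; written without division it makes sense even when \<open>V\<close> has fewer than \<open>k + k' - 1\<close>
  elements.
\<close>

lemma card_subcube_Int_dvd:
  assumes "finite V" "K \<subseteq> V" "P \<subseteq> K" "K' \<subseteq> V" "P' \<subseteq> K'"
    and "K \<inter> K' \<noteq> {}"
  shows "2 ^ card V dvd 2 ^ (card K + card K' - 1) * card (subcube V K P \<inter> subcube V K' P')"
proof (cases "P \<inter> K' = P' \<inter> K")
  case True
  have fin: "finite K" "finite K'"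
    using assms finite_subset by blast+
  then have "card (K \<inter> K') > 0"
    using assms by (simp add: card_gt_0_iff)
  then have "card (K \<union> K') \<le> card K + card K' - 1"
    using card_Un_Int[OF fin] by linarith
  then have "(2::nat) ^ card (K \<union> K') dvd 2 ^ (card K + card K' - 1)"
    by (rule le_imp_power_dvd)
  moreover have "2 ^ card (K \<union> K') * card (subcube V K P \<inter> subcube V K' P') = 2 ^ card V"
  proof -
    have "P \<union> P' \<subseteq> K \<union> K'" "K \<union> K' \<subseteq> V"
      using assms by blast+
    with card_subcube[OF assms(1), of "K \<union> K'" "P \<union> P'"] subcube_Int_eq[of P K P' K' V]
    show ?thesis
      using True assms(3,5) by simp
  qed
  ultimately show ?thesis
    by (metis dvd_refl mult_dvd_mono)
next
  case False
  then show ?thesis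
    using subcube_Int_eq[of P K P' K' V] assms by simp
qed

text \<open>
  The fibre over \<open>Q\<close> and its intersections with the given subcubes all have densities that are
  multiples of \<open>2 ^ (-(2m-1))\<close>: a clash with \<open>k\<close> requires a coordinate shared with \<open>K k\<close>, while the subcube
  of \<open>k\<close> itself misses the fibre since \<open>Q \<noteq> P k\<close>. By disjointness the uncovered remainder inherits
  this divisibility, so it is large as soon as it is nonempty.
\<close>

lemma uncovered_part_of_subcube:
  assumes V: "finite V" and I: "finite I"
    and KP: "\<And>i. i \<in> I \<Longrightarrow> K i \<subseteq> V \<and> P i \<subseteq> K i \<and> card (K i) = m"
    and clash: "\<And>i j. i \<in> I \<Longrightarrow> j \<in> I \<Longrightarrow> i \<noteq> j \<Longrightarrow> P i \<inter> K j \<noteq> P j \<inter> K i"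
    and k: "k \<in> I" and Q: "Q \<subseteq> K k" "Q \<noteq> P k"
    and unc: "\<exists>S\<in>subcube V (K k) Q. \<forall>i\<in>I. S \<inter> K i \<noteq> P i"
  defines "cube \<equiv> \<lambda>i. subcube V (K i) (P i)"
  shows "2 ^ card V \<le> 2 ^ (2 * m - 1) * card (subcube V (K k) Q - (\<Union>i\<in>I. cube i))"
proof -
  let ?C = "subcube V (K k) Q" and ?U = "subcube V (K k) Q - (\<Union>i\<in>I. cube i)"
  have fin: "finite (subcube V A B)" for A B
    using V by (simp add: subcube_def)
  have disj: "cube i \<inter> cube j = {}" if "i \<in> I" "j \<in> I" "i \<noteq> j" for i j
    using subcube_Int_eq[of "P i" "K i" "P j" "K j" V] clash[OF that] KP that
    by (auto simp: cube_def)
  have "m > 0"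
    using unc V KP[OF k] Q k by (metis card_gt_0_iff finite_subset neq0_conv subset_empty)
  have "?C = ?U \<union> (\<Union>i\<in>I. ?C \<inter> cube i)"
    by auto
  then have "card ?C = card ?U + card (\<Union>i\<in>I. ?C \<inter> cube i)"
    by (subst card_Un_disjoint[symmetric]) (auto simp: fin I)
  also have "card (\<Union>i\<in>I. ?C \<inter> cube i) = (\<Sum>i\<in>I. card (?C \<inter> cube i))"
    by (rule card_UN_disjoint) (use disj I fin in auto)
  finally have split: "card ?C = card ?U + (\<Sum>i\<in>I. card (?C \<inter> cube i))" .
  have "2 ^ card V dvd 2 ^ (2 * m - 1) * card (?C \<inter> cube i)" if "i \<in> I" for i
  proof (cases "i = k")
    case True
    then have "?C \<inter> cube i = {}"
      using Q by (auto simp: subcube_def cube_def)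
    then show ?thesis by simp
  next
    case False
    then have "K k \<inter> K i \<noteq> {}"
      using clash[OF that k] KP[OF that] KP[OF k] by blast
    with card_subcube_Int_dvd[of V "K k" Q "K i" "P i"] show ?thesis
      using V KP[OF that] KP[OF k] Q by (simp add: cube_def mult_2)
  qed
  then have "2 ^ card V dvd 2 ^ (2 * m - 1) * (\<Sum>i\<in>I. card (?C \<inter> cube i))"
    by (simp add: sum_distrib_left dvd_sum)
  moreover have "2 ^ card V dvd 2 ^ (2 * m - 1) * card ?C"
  proof -
    have "2 ^ m * card ?C = 2 ^ card V"
      using card_subcube[of V "K k" Q] V KP[OF k] Q by simp
    moreover have "(2::nat) ^ m dvd 2 ^ (2 * m - 1)"
      using \<open>m > 0\<close> by (intro le_imp_power_dvd) simp
    ultimately show ?thesis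
      by (metis dvd_refl mult_dvd_mono)
  qed
  ultimately have "2 ^ card V dvd 2 ^ (2 * m - 1) * card ?U"
    unfolding split distrib_left by (metis dvd_add_left_iff)
  moreover have "card ?U > 0"
  proof -
    obtain S where "S \<in> ?C" "\<forall>i\<in>I. S \<inter> K i \<noteq> P i"
      using unc by blast
    then have "S \<in> ?U"
      by (simp add: cube_def subcube_def)
    then show ?thesis
      unfolding card_gt_0_iff using fin by blast
  qed
  ultimately show ?thesis
    by (intro dvd_imp_le) simp_all
qed

text \<open>
  The fibres over the patterns \<open>Q\<close> are disjoint, so their uncovered parts add up; comparing with the
  total mass of the cube leaves an error term \<open>1 / 2 ^ (m-2)\<close>, which rounding removes exactly when
  \<open>m \<ge> 3\<close>.
\<close>

lemma card_clashing_subcubes_le: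
  assumes V: "finite V" and I: "finite I" and m: "m \<ge> 3"
    and KP: "\<And>i. i \<in> I \<Longrightarrow> K i \<subseteq> V \<and> P i \<subseteq> K i \<and> card (K i) = m"
    and clash: "\<And>i j. i \<in> I \<Longrightarrow> j \<in> I \<Longrightarrow> i \<noteq> j \<Longrightarrow> P i \<inter> K j \<noteq> P j \<inter> K i"
    and k: "k \<in> I"
    and unc: "\<And>Q. Q \<subseteq> K k \<Longrightarrow> Q \<noteq> P k \<Longrightarrow> Q \<noteq> K k - P k \<Longrightarrow>
                \<exists>S\<in>subcube V (K k) Q. \<forall>i\<in>I. S \<inter> K i \<noteq> P i"
  shows "card I \<le> 2 ^ m - 2"
proof -
  define cube where "cube = (\<lambda>i. subcube V (K i) (P i))"
  define U where "U = (\<lambda>Q. subcube V (K k) Q - (\<Union>i\<in>I. cube i))"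
  define \<Q> where "\<Q> = Pow (K k) - {P k, K k - P k}"
  have fin: "finite (subcube V A B)" for A B
    using V by (simp add: subcube_def)
  have finK: "finite (K k)"
    using V KP[OF k] finite_subset by blast
  have disj: "cube i \<inter> cube j = {}" if "i \<in> I" "j \<in> I" "i \<noteq> j" for i j
    using subcube_Int_eq[of "P i" "K i" "P j" "K j" V] clash[OF that] KP that
    by (auto simp: cube_def)
  have "card {P k, K k - P k} \<le> 2"
    by (simp add: card_insert_if)
  moreover have "card (Pow (K k)) - card {P k, K k - P k} \<le> card \<Q>"
    unfolding \<Q>_def by (rule diff_card_le_card_Diff) simp
  ultimately have card_Q: "2 ^ m - 2 \<le> card \<Q>"
    using KP[OF k] finK by (simp add: card_Pow)
  have "(2 ^ m - 2) * 2 ^ card V \<le> card \<Q> * 2 ^ card V"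
    using card_Q by simp
  also have "\<dots> = (\<Sum>Q\<in>\<Q>. 2 ^ card V)"
    by simp
  also have "\<dots> \<le> (\<Sum>Q\<in>\<Q>. 2 ^ (2 * m - 1) * card (U Q))"
  proof (rule sum_mono)
    fix Q assume "Q \<in> \<Q>"
    then show "2 ^ card V \<le> 2 ^ (2 * m - 1) * card (U Q)"
      unfolding U_def cube_def \<Q>_def
      by (intro uncovered_part_of_subcube[OF V I KP clash k _ _ unc]) auto
  qed
  also have "\<dots> = 2 ^ (2 * m - 1) * (\<Sum>Q\<in>\<Q>. card (U Q))"
    by (simp add: sum_distrib_left)
  also have "(\<Sum>Q\<in>\<Q>. card (U Q)) = card (\<Union>Q\<in>\<Q>. U Q)"
    by (rule card_UN_disjoint[symmetric]) (use finK fin in \<open>auto simp: \<Q>_def U_def subcube_def\<close>)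
  finally have many: "(2 ^ m - 2) * 2 ^ card V \<le> 2 ^ (2 * m - 1) * card (\<Union>Q\<in>\<Q>. U Q)" .
  have "card (\<Union>Q\<in>\<Q>. U Q) + card (\<Union>i\<in>I. cube i) = card ((\<Union>Q\<in>\<Q>. U Q) \<union> (\<Union>i\<in>I. cube i))"
    by (rule card_Un_disjoint[symmetric])
       (use finK I fin in \<open>auto simp: \<Q>_def U_def cube_def\<close>)
  also have "\<dots> \<le> card (Pow V)"
    by (rule card_mono) (use V in \<open>auto simp: U_def cube_def subcube_def\<close>)
  also have "card (\<Union>i\<in>I. cube i) = (\<Sum>i\<in>I. card (cube i))"
    by (rule card_UN_disjoint) (use I fin disj in \<open>auto simp: cube_def\<close>)
  finally have le: "card (\<Union>Q\<in>\<Q>. U Q) + (\<Sum>i\<in>I. card (cube i)) \<le> 2 ^ card V"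
    using V by (simp add: card_Pow)
  have "2 ^ m * (\<Sum>i\<in>I. card (cube i)) = card I * 2 ^ card V"
  proof -
    have "2 ^ m * card (cube i) = 2 ^ card V" if "i \<in> I" for i
      using card_subcube[of V "K i" "P i"] V KP[OF that] by (simp add: cube_def)
    then show ?thesis
      by (simp add: sum_distrib_left)
  qed
  moreover have pow: "(2::nat) ^ (2 * m - 1) = 2 ^ (m - 1) * 2 ^ m"
    using m by (simp flip: power_add)
  ultimately have cov:
    "2 ^ (2 * m - 1) * (\<Sum>i\<in>I. card (cube i)) = 2 ^ (m - 1) * card I * 2 ^ card V"
    by (metis mult.assoc)
  have "(2 ^ m - 2 + 2 ^ (m - 1) * card I) * 2 ^ card V
      \<le> 2 ^ (2 * m - 1) * (card (\<Union>Q\<in>\<Q>. U Q) + (\<Sum>i\<in>I. card (cube i)))"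
    using many cov by (simp add: distrib_left distrib_right)
  also have "\<dots> \<le> 2 ^ (2 * m - 1) * 2 ^ card V"
    using le by simp
  finally have "2 ^ m - 2 + 2 ^ (m - 1) * card I \<le> (2::nat) ^ (2 * m - 1)"
    by simp
  then have main: "2 ^ m - 2 + 2 ^ (m - 1) * card I \<le> (2::nat) ^ (m - 1) * 2 ^ m"
    using pow by simp
  show ?thesis
  proof (rule ccontr)
    define q where "q = (2::nat) ^ (m - 1)"
    assume "\<not> ?thesis"
    then have "2 ^ m \<le> card I + 1"
      by linarith
    then have "q * 2 ^ m \<le> q * card I + q"
      by (metis distrib_left mult.right_neutral mult_le_mono2)
    moreover have "(2::nat) ^ m = 2 * q"
      using m by (cases m) (auto simp: q_def)
    moreover have "q \<ge> 4"
      using m power_increasing[of 2 "m - 1" "2::nat"] by (simp add: q_def)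
    ultimately show False
      using main unfolding q_def[symmetric] by linarith
  qed
qed

section \<open>Facet hyperplanes of a full-dimensional simplex\<close>

text \<open>
  The sign of a simplex at a hyperplane must be comparable between simplices that share this
  hyperplane, so the orientation may depend only on the hyperplane as a set. A fixed choice of
  equation for each set achieves this.
\<close>

definition normal :: "'a::euclidean_space set \<Rightarrow> 'a" where
  "normal h = (SOME a. \<exists>b. a \<noteq> 0 \<and> h = {x. a \<bullet> x = b})"

definition offset :: "'a::euclidean_space set \<Rightarrow> real" where
  "offset h = (SOME b. h = {x. normal h \<bullet> x = b})"

lemma normal_offset:
  assumes "a \<noteq> 0" "h = {x. a \<bullet> x = b}"
  shows "h = {x. normal h \<bullet> x = offset h}"
proof -
  have "\<exists>a b. a \<noteq> 0 \<and> h = {x. a \<bullet> x = b}"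
    using assms by blast
  then have "\<exists>b. normal h \<noteq> 0 \<and> h = {x. normal h \<bullet> x = b}"
    unfolding normal_def by (rule someI_ex)
  then have "\<exists>b. h = {x. normal h \<bullet> x = b}"
    by blast
  then show ?thesis
    unfolding offset_def by (rule someI_ex)
qed

definition facet_hyp :: "'a::euclidean_space set \<Rightarrow> 'a \<Rightarrow> 'a set" where
  "facet_hyp C c = affine hull (C - {c})"

definition facet_hyps :: "'a::euclidean_space set \<Rightarrow> 'a set set" where
  "facet_hyps C = facet_hyp C ` C"

definition positive_hyps :: "'a::euclidean_space set \<Rightarrow> 'a set set" where
  "positive_hyps C =
    facet_hyp C ` {c \<in> C. normal (facet_hyp C c) \<bullet> c > offset (facet_hyp C c)}"

locale full_simplex =
  fixes C :: "'a::euclidean_space set"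
  assumes indep: "\<not> affine_dependent C" and card: "card C = DIM('a) + 1"
begin

lemma finite_vertices: "finite C"
  using indep by (rule aff_independent_finite)

lemma aff_dim_facet_hyp:
  assumes "c \<in> C"
  shows "aff_dim (facet_hyp C c) = int DIM('a) - 1"
proof -
  have "int (card (C - {c})) = aff_dim (C - {c}) + 1"
    by (intro aff_dim_affine_independent affine_independent_Diff indep)
  then show ?thesis
    using assms card by (simp add: facet_hyp_def aff_dim_affine_hull)
qed

lemma facet_hyp_eq:
  assumes "c \<in> C"
  shows "facet_hyp C c = {x. normal (facet_hyp C c) \<bullet> x = offset (facet_hyp C c)}"
proof -
  have "aff_dim (C - {c}) = int DIM('a) - 1"
    using aff_dim_facet_hyp[OF assms] by (simp add: facet_hyp_def aff_dim_affine_hull)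
  then obtain a b where "a \<noteq> 0" "facet_hyp C c = {x. a \<bullet> x = b}"
    using aff_dim_eq_hyperplane[of "C - {c}"] unfolding facet_hyp_def by auto
  then show ?thesis
    by (rule normal_offset)
qed

text \<open>
  The opposite vertex is the only one off a facet hyperplane, so its height decides on which side
  the simplex lies.
\<close>

lemma mem_facet_hyp_iff:
  assumes "c \<in> C" "e \<in> C"
  shows "e \<in> facet_hyp C c \<longleftrightarrow> e \<noteq> c"
proof (cases "e = c")
  case True
  then show ?thesis
    using assms indep unfolding facet_hyp_def affine_dependent_def by blast
next
  case False
  then show ?thesis
    using assms by (simp add: facet_hyp_def hull_inc)
qed

lemma vertex_on_facet_hyp_iff:
  assumes "c \<in> C" "e \<in> C"
  shows "normal (facet_hyp C c) \<bullet> e = offset (facet_hyp C c) \<longleftrightarrow> e \<noteq> c"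
proof -
  have "e \<in> facet_hyp C c \<longleftrightarrow> normal (facet_hyp C c) \<bullet> e = offset (facet_hyp C c)"
    by (subst facet_hyp_eq[OF assms(1)]) simp
  then show ?thesis
    using mem_facet_hyp_iff[OF assms] by simp
qed

lemma inj_on_facet_hyp: "inj_on (facet_hyp C) C"
  by (rule inj_onI) (metis mem_facet_hyp_iff)

lemma card_facet_hyps: "card (facet_hyps C) = DIM('a) + 1"
  using inj_on_facet_hyp card by (simp add: facet_hyps_def card_image)

lemma finite_facet_hyps: "finite (facet_hyps C)"
  using finite_vertices by (simp add: facet_hyps_def)

lemma positive_hyps_subset: "positive_hyps C \<subseteq> facet_hyps C"
  by (auto simp: positive_hyps_def facet_hyps_def)

lemma facet_hyp_mem_positive_hyps_iff:
  assumes "c \<in> C"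
  shows "facet_hyp C c \<in> positive_hyps C \<longleftrightarrow>
    normal (facet_hyp C c) \<bullet> c > offset (facet_hyp C c)"
  using inj_on_image_mem_iff[OF inj_on_facet_hyp assms,
      of "{c \<in> C. normal (facet_hyp C c) \<bullet> c > offset (facet_hyp C c)}"] assms
  unfolding positive_hyps_def by simp

text \<open>
  A direction \<open>\<Sum>e\<in>C. t e *\<^sub>R e\<close> with \<open>sum t C = 0\<close> changes the barycentric coordinate of \<open>c\<close> at rate \<open>t c\<close>.
  The equation of the hyperplane opposite \<open>c\<close> is a multiple of that coordinate, because it vanishes
  at all other vertices.
\<close>

lemma normal_inner_combination:
  assumes t: "sum t C = 0" and c: "c \<in> C"
  shows "normal (facet_hyp C c) \<bullet> (\<Sum>e\<in>C. t e *\<^sub>R e) =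
    t c * (normal (facet_hyp C c) \<bullet> c - offset (facet_hyp C c))"
proof -
  let ?a = "normal (facet_hyp C c)" and ?b = "offset (facet_hyp C c)"
  have "?a \<bullet> (\<Sum>e\<in>C. t e *\<^sub>R e) = (\<Sum>e\<in>C. t e * (?a \<bullet> e - ?b)) + ?b * sum t C"
    by (simp add: inner_sum_right right_diff_distrib sum_subtractf sum_distrib_left
        mult.commute[of ?b])
  also have "(\<Sum>e\<in>C. t e * (?a \<bullet> e - ?b)) = (\<Sum>e\<in>C. if e = c then t c * (?a \<bullet> c - ?b) else 0)"
    by (rule sum.cong) (use vertex_on_facet_hyp_iff[OF c] in auto)
  also have "\<dots> = t c * (?a \<bullet> c - ?b)"
    using finite_vertices c by simp
  finally show ?thesis
    using t by simp
qed

text \<open>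
  The signs of the rates \<open>t c\<close> can be prescribed freely, provided that both signs occur, since only
  their sum has to vanish. The two excluded patterns \<open>Q\<close> are those that would make all rates
  positive or all rates negative.
\<close>

lemma direction_with_signs:
  assumes Q: "Q \<subseteq> facet_hyps C" "Q \<noteq> positive_hyps C" "Q \<noteq> facet_hyps C - positive_hyps C"
  obtains u where "u \<noteq> 0" "{h. normal h \<bullet> u > 0} \<inter> facet_hyps C = Q"
proof -
  \<comment> \<open>\<open>A\<close> collects the vertices whose barycentric coordinate has to grow in direction \<open>u\<close>.\<close>
  define A where "A = {c \<in> C. facet_hyp C c \<in> Q \<longleftrightarrow> facet_hyp C c \<in> positive_hyps C}"
  define t where "t c = (if c \<in> A then real (card (C - A)) else - real (card A))" for c
  define u where "u = (\<Sum>e\<in>C. t e *\<^sub>R e)"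
  have AC: "A \<subseteq> C" and fin: "finite A"
    using finite_vertices by (auto simp: A_def)
  have "A \<noteq> {}"
    using Q(1,3) positive_hyps_subset unfolding A_def facet_hyps_def by blast
  moreover have "A \<noteq> C"
    using Q(1,2) positive_hyps_subset unfolding A_def facet_hyps_def by blast
  ultimately have pos: "card A > 0" "card (C - A) > 0"
    using AC fin finite_vertices by (auto simp: card_gt_0_iff)
  have "sum t C = sum t A + sum t (C - A)"
    using AC finite_vertices by (metis add.commute sum.subset_diff)
  also have "\<dots> = 0"
    by (simp add: t_def)
  finally have t0: "sum t C = 0" .
  have sign: "normal (facet_hyp C c) \<bullet> u \<noteq> 0 \<and>
      (normal (facet_hyp C c) \<bullet> u > 0 \<longleftrightarrow> facet_hyp C c \<in> Q)" if c: "c \<in> C" for c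
  proof -
    define s where "s = normal (facet_hyp C c) \<bullet> c - offset (facet_hyp C c)"
    have "normal (facet_hyp C c) \<bullet> u = t c * s"
      using normal_inner_combination[OF t0 c] by (simp add: u_def s_def)
    moreover have "s \<noteq> 0"
      using vertex_on_facet_hyp_iff[OF c c] by (simp add: s_def)
    moreover have "s > 0 \<longleftrightarrow> facet_hyp C c \<in> positive_hyps C"
      using facet_hyp_mem_positive_hyps_iff[OF c] by (simp add: s_def)
    moreover have "t c \<noteq> 0" "t c > 0 \<longleftrightarrow> c \<in> A"
      using pos by (auto simp: t_def)
    moreover have "c \<in> A \<longleftrightarrow> (facet_hyp C c \<in> Q \<longleftrightarrow> facet_hyp C c \<in> positive_hyps C)"
      using c by (simp add: A_def)
    ultimately show ?thesis
      by (auto simp: zero_less_mult_iff)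
  qed
  show thesis
  proof
    from \<open>A \<noteq> {}\<close> AC obtain c where "c \<in> C" by blast
    then show "u \<noteq> 0"
      using sign by fastforce
    show "{h. normal h \<bullet> u > 0} \<inter> facet_hyps C = Q"
      using sign Q(1) unfolding facet_hyps_def by blast
  qed
qed

text \<open>
  Full dimension makes every \<open>u\<close> a combination of the vertices with coefficient sum \<open>0\<close>. If the signs
  of \<open>u\<close> were those of the simplex, no barycentric coordinate would decrease; as their sum is
  constant, none would change at all, and \<open>u\<close> would be zero. Hyperplanes parallel to \<open>u\<close> count as
  negative here, and the argument covers them because it only needs \<open>t c \<ge> 0\<close>.
\<close>

lemma no_recession_direction:
  assumes "u \<noteq> 0"
  shows "{h. normal h \<bullet> u > 0} \<inter> facet_hyps C \<noteq> positive_hyps C"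
proof
  assume eq: "{h. normal h \<bullet> u > 0} \<inter> facet_hyps C = positive_hyps C"
  have "affine hull C = UNIV"
    using indep card by (simp add: affine_independent_span_eq)
  then have ex: "\<exists>w. sum w C = 1 \<and> (\<Sum>e\<in>C. w e *\<^sub>R e) = x" for x
    using affine_hull_finite[OF finite_vertices] by blast
  obtain v w where v: "sum v C = 1" "(\<Sum>e\<in>C. v e *\<^sub>R e) = u"
    and w: "sum w C = 1" "(\<Sum>e\<in>C. w e *\<^sub>R e) = 0"
    using ex[of u] ex[of 0] by blast
  define t where "t e = v e - w e" for e
  have t0: "sum t C = 0" and u: "(\<Sum>e\<in>C. t e *\<^sub>R e) = u"
    using v w by (simp_all add: t_def sum_subtractf scaleR_left_diff_distrib)
  have "t c \<ge> 0" if c: "c \<in> C" for c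
  proof -
    define s where "s = normal (facet_hyp C c) \<bullet> c - offset (facet_hyp C c)"
    have "normal (facet_hyp C c) \<bullet> u = t c * s"
      using normal_inner_combination[OF t0 c] by (simp add: u s_def)
    moreover have "s \<noteq> 0"
      using vertex_on_facet_hyp_iff[OF c c] by (simp add: s_def)
    moreover have "s > 0 \<longleftrightarrow> facet_hyp C c \<in> positive_hyps C"
      using facet_hyp_mem_positive_hyps_iff[OF c] by (simp add: s_def)
    moreover have "normal (facet_hyp C c) \<bullet> u > 0 \<longleftrightarrow> facet_hyp C c \<in> positive_hyps C"
      using eq c unfolding facet_hyps_def by blast
    ultimately show ?thesis
      by (metis linorder_not_le mult_neg_neg mult_neg_pos not_less_iff_gr_or_eq)
  qed
  then have "\<forall>c\<in>C. t c = 0"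
    using t0 finite_vertices by (simp add: sum_nonneg_eq_0_iff)
  then have "u = 0"
    using u by (metis (no_types, lifting) scale_zero_left sum.neutral)
  with assms show False ..
qed

text \<open>
  A separating hyperplane is a facet hyperplane of the simplex, since both have the same dimension.
\<close>

lemma facet_in_hyperplane:
  assumes f: "f facet_of convex hull C" "f \<subseteq> {x. a \<bullet> x = b}" and a: "a \<noteq> 0"
  obtains c where "c \<in> C" "facet_hyp C c = {x. a \<bullet> x = b}" "a \<bullet> c \<noteq> b"
proof -
  obtain c where c: "c \<in> C" "f = convex hull (C - {c})" "f \<noteq> {}"
    using f(1) facet_of_convex_hull_affine_independent[OF indep] by blast
  have eq: "facet_hyp C c = {x. a \<bullet> x = b}"
  proof (rule affine_dim_equal)
    show "affine (facet_hyp C c)" "affine {x. a \<bullet> x = b}"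
      by (simp_all add: facet_hyp_def affine_hyperplane)
    show "facet_hyp C c \<noteq> {}"
      using c by (auto simp: facet_hyp_def)
    have "C - {c} \<subseteq> {x. a \<bullet> x = b}"
      using c(2) f(2) hull_subset[of "C - {c}" convex] by simp
    then show "facet_hyp C c \<subseteq> {x. a \<bullet> x = b}"
      unfolding facet_hyp_def by (simp add: affine_hyperplane hull_minimal)
    show "aff_dim (facet_hyp C c) = aff_dim {x. a \<bullet> x = b}"
      using aff_dim_facet_hyp[OF c(1)] a by simp
  qed
  with c mem_facet_hyp_iff[of c c] that show thesis
    by blast
qed

end

text \<open>
  The equation that comes with the separation and the chosen equation of the same hyperplane \<open>h\<close> may
  differ by a factor of either sign. What they share is the point where the segment between the two
  vertices opposite \<open>h\<close> crosses \<open>h\<close>; it shows that these vertices have opposite signs for the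
  chosen equation too.
\<close>

lemma facet_separated_imp_clash:
  assumes C: "full_simplex C" and D: "full_simplex D"
    and sep: "facet_separated (convex hull C) (convex hull D)"
  shows "positive_hyps C \<inter> facet_hyps D \<noteq> positive_hyps D \<inter> facet_hyps C"
proof -
  interpret C: full_simplex C by fact
  interpret D: full_simplex D by fact
  obtain a b f g where a: "a \<noteq> 0"
    and f: "f facet_of convex hull C" "f \<subseteq> {x. a \<bullet> x = b}"
    and g: "g facet_of convex hull D" "g \<subseteq> {x. a \<bullet> x = b}"
    and sides: "convex hull C \<subseteq> {x. a \<bullet> x \<le> b}" "convex hull D \<subseteq> {x. a \<bullet> x \<ge> b}"
    using sep unfolding facet_separated_def by blast
  define h where "h = {x. a \<bullet> x = b}"
  obtain c where c: "c \<in> C" "facet_hyp C c = h" "a \<bullet> c \<noteq> b"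
    using C.facet_in_hyperplane[OF f a] unfolding h_def by blast
  obtain d where d: "d \<in> D" "facet_hyp D d = h" "a \<bullet> d \<noteq> b"
    using D.facet_in_hyperplane[OF g a] unfolding h_def by blast
  have "c \<in> convex hull C" "d \<in> convex hull D"
    using c(1) d(1) by (auto intro: hull_inc)
  then have less: "a \<bullet> c < b" "b < a \<bullet> d"
    using sides c(3) d(3) by fastforce+
  \<comment> \<open>\<open>\<alpha>\<close> and \<open>\<beta>\<close> are the weights of \<open>c\<close> and \<open>d\<close> at the crossing point.\<close>
  define \<delta> where "\<delta> = a \<bullet> d - a \<bullet> c"
  define \<alpha> where "\<alpha> = (a \<bullet> d - b) / \<delta>"
  define \<beta> where "\<beta> = (b - a \<bullet> c) / \<delta>"
  have \<delta>: "\<delta> > 0"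
    using less by (simp add: \<delta>_def)
  then have pos: "\<alpha> > 0" "\<beta> > 0"
    using less by (simp_all add: \<alpha>_def \<beta>_def)
  have "\<alpha> + \<beta> = \<delta> / \<delta>"
    unfolding \<alpha>_def \<beta>_def add_divide_distrib[symmetric] by (simp add: \<delta>_def)
  with \<delta> have sum: "\<alpha> + \<beta> = 1"
    by simp
  have "a \<bullet> (\<alpha> *\<^sub>R c + \<beta> *\<^sub>R d) = ((a \<bullet> d - b) * (a \<bullet> c) + (b - a \<bullet> c) * (a \<bullet> d)) / \<delta>"
    by (simp add: \<alpha>_def \<beta>_def inner_add_right add_divide_distrib)
  also have "(a \<bullet> d - b) * (a \<bullet> c) + (b - a \<bullet> c) * (a \<bullet> d) = b * \<delta>"
    by (simp add: \<delta>_def algebra_simps)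
  finally have "a \<bullet> (\<alpha> *\<^sub>R c + \<beta> *\<^sub>R d) = b"
    using \<delta> by simp
  then have "\<alpha> *\<^sub>R c + \<beta> *\<^sub>R d \<in> h"
    by (simp add: h_def)
  then have "normal h \<bullet> (\<alpha> *\<^sub>R c + \<beta> *\<^sub>R d) = (\<alpha> + \<beta>) * offset h"
    using C.facet_hyp_eq[OF c(1)] c(2) sum by auto
  then have bal: "\<alpha> * (normal h \<bullet> c - offset h) + \<beta> * (normal h \<bullet> d - offset h) = 0"
    by (simp add: inner_add_right algebra_simps)
  define x where "x = normal h \<bullet> c - offset h"
  define y where "y = normal h \<bullet> d - offset h"
  have "x \<noteq> 0"
    using C.vertex_on_facet_hyp_iff[OF c(1) c(1)] c(2) by (simp add: x_def)
  moreover have "\<alpha> * x = - (\<beta> * y)"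
    using bal by (simp add: x_def y_def)
  moreover have "\<alpha> * x > 0 \<longleftrightarrow> x > 0" "\<alpha> * x < 0 \<longleftrightarrow> x < 0" "\<beta> * y > 0 \<longleftrightarrow> y > 0"
    using pos by (simp_all add: zero_less_mult_iff mult_less_0_iff)
  ultimately have "x > 0 \<longleftrightarrow> \<not> y > 0"
    by linarith
  then have "h \<in> positive_hyps C \<longleftrightarrow> h \<notin> positive_hyps D"
    using C.facet_hyp_mem_positive_hyps_iff[OF c(1)] D.facet_hyp_mem_positive_hyps_iff[OF d(1)]
      c(2) d(2) by (simp add: x_def y_def)
  moreover have "h \<in> facet_hyps C" "h \<in> facet_hyps D"
    using c d by (auto simp: facet_hyps_def)
  ultimately show ?thesis
    by blast
qed

section \<open>Counting simplices\<close>

lemma card_nearly_neighbourly_le: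
  fixes F :: "'a::euclidean_space set set"
  assumes fin: "finite F" and dim: "DIM('a) \<ge> 2"
    and simp: "\<And>\<sigma>. \<sigma> \<in> F \<Longrightarrow> int DIM('a) simplex \<sigma>"
    and nn: "nearly_neighbourly F"
  shows "card F \<le> 2 ^ (DIM('a) + 1) - 2"
proof (cases "F = {}")
  case False
  then obtain \<kappa> where \<kappa>: "\<kappa> \<in> F" by blast
  have "\<exists>C. full_simplex C \<and> \<sigma> = convex hull C" if "\<sigma> \<in> F" for \<sigma>
    using simp[OF that] unfolding simplex_def full_simplex_def by force
  then obtain vert where vert: "\<And>\<sigma>. \<sigma> \<in> F \<Longrightarrow> full_simplex (vert \<sigma>)"
    "\<And>\<sigma>. \<sigma> \<in> F \<Longrightarrow> \<sigma> = convex hull (vert \<sigma>)"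
    by metis
  define K where "K \<sigma> = facet_hyps (vert \<sigma>)" for \<sigma>
  define P where "P \<sigma> = positive_hyps (vert \<sigma>)" for \<sigma>
  define V where "V = (\<Union>\<sigma>\<in>F. K \<sigma>)"
  show ?thesis
  proof (rule card_clashing_subcubes_le)
    show "finite V"
      using fin vert by (auto simp: V_def K_def full_simplex.finite_facet_hyps)
    show "finite F" "\<kappa> \<in> F" "3 \<le> DIM('a) + 1"
      using fin \<kappa> dim by auto
    show "K \<sigma> \<subseteq> V \<and> P \<sigma> \<subseteq> K \<sigma> \<and> card (K \<sigma>) = DIM('a) + 1" if "\<sigma> \<in> F" for \<sigma>
      using that full_simplex.positive_hyps_subset[OF vert(1)[OF that]]
        full_simplex.card_facet_hyps[OF vert(1)[OF that]]
      by (auto simp: V_def K_def P_def)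
    show "P \<sigma> \<inter> K \<tau> \<noteq> P \<tau> \<inter> K \<sigma>" if "\<sigma> \<in> F" "\<tau> \<in> F" "\<sigma> \<noteq> \<tau>" for \<sigma> \<tau>
      unfolding P_def K_def
      by (intro facet_separated_imp_clash vert that)
        (use nn that vert(2) in \<open>metis nearly_neighbourly_def\<close>)
    show "\<exists>S\<in>subcube V (K \<kappa>) Q. \<forall>\<sigma>\<in>F. S \<inter> K \<sigma> \<noteq> P \<sigma>"
      if Q: "Q \<subseteq> K \<kappa>" "Q \<noteq> P \<kappa>" "Q \<noteq> K \<kappa> - P \<kappa>" for Q
    proof -
      obtain u where u: "u \<noteq> 0" "{h. normal h \<bullet> u > 0} \<inter> K \<kappa> = Q"
        using full_simplex.direction_with_signs[OF vert(1)[OF \<kappa>] Q[unfolded K_def P_def]]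
        unfolding K_def .
      have restrict: "{h. normal h \<bullet> u > 0} \<inter> V \<inter> K \<sigma> = {h. normal h \<bullet> u > 0} \<inter> K \<sigma>"
        if "\<sigma> \<in> F" for \<sigma>
        using that by (auto simp: V_def)
      show ?thesis
      proof (rule bexI[of _ "{h. normal h \<bullet> u > 0} \<inter> V"])
        show "\<forall>\<sigma>\<in>F. {h. normal h \<bullet> u > 0} \<inter> V \<inter> K \<sigma> \<noteq> P \<sigma>"
          using restrict full_simplex.no_recession_direction[OF vert(1) u(1)]
          unfolding K_def P_def by simp
        show "{h. normal h \<bullet> u > 0} \<inter> V \<in> subcube V (K \<kappa>) Q"
          using restrict[OF \<kappa>] u(2) by (simp add: subcube_def)
      qed
    qed
  qed
qed simp

text \<open>
  On a line a hyperplane is a single point, so the two facets coincide: \<open>u\<close> is the end of one set and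
  the beginning of the other.
\<close>

lemma facet_separated_line:
  fixes \<sigma> \<tau> :: "'a::euclidean_space set"
  assumes e: "Basis = {e}" and sep: "facet_separated \<sigma> \<tau>"
  shows "\<exists>u\<in>\<sigma> \<inter> \<tau>. (\<forall>x\<in>\<sigma>. \<forall>y\<in>\<tau>. x \<bullet> e \<le> u \<bullet> e \<and> u \<bullet> e \<le> y \<bullet> e) \<or>
    (\<forall>x\<in>\<sigma>. \<forall>y\<in>\<tau>. y \<bullet> e \<le> u \<bullet> e \<and> u \<bullet> e \<le> x \<bullet> e)"
proof -
  obtain a b f g where a: "a \<noteq> 0"
    and f: "f facet_of \<sigma>" "f \<subseteq> {x. a \<bullet> x = b}"
    and g: "g facet_of \<tau>" "g \<subseteq> {x. a \<bullet> x = b}"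
    and sides: "\<sigma> \<subseteq> {x. a \<bullet> x \<le> b}" "\<tau> \<subseteq> {x. a \<bullet> x \<ge> b}"
    using sep unfolding facet_separated_def by blast
  have inner: "x \<bullet> y = (x \<bullet> e) * (y \<bullet> e)" for x y :: 'a
    unfolding euclidean_inner[of x y] e by simp
  have nz: "a \<bullet> e \<noteq> 0"
    using a inner[of a a] by auto
  obtain u v where "u \<in> f" "v \<in> g"
    using f(1) g(1) by (auto simp: facet_of_def)
  then have u: "u \<in> \<sigma>" "a \<bullet> u = b" and v: "v \<in> \<tau>" "a \<bullet> v = b"
    using f g facet_of_imp_subset by blast+
  have "u \<bullet> e = v \<bullet> e"
    using u(2) v(2) nz inner[of a u] inner[of a v] by (metis mult_left_cancel)
  then have "u = v"
    using euclidean_eqI[of u v] unfolding e by blast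
  have le: "a \<bullet> e * (x \<bullet> e) \<le> a \<bullet> e * (u \<bullet> e)" if "x \<in> \<sigma>" for x
    using sides(1) that u(2) inner[of a x] inner[of a u] by auto
  have ge: "a \<bullet> e * (u \<bullet> e) \<le> a \<bullet> e * (y \<bullet> e)" if "y \<in> \<tau>" for y
    using sides(2) that u(2) inner[of a y] inner[of a u] by auto
  show ?thesis
  proof (rule bexI[of _ u])
    show "u \<in> \<sigma> \<inter> \<tau>" using u v \<open>u = v\<close> by simp
    show "(\<forall>x\<in>\<sigma>. \<forall>y\<in>\<tau>. x \<bullet> e \<le> u \<bullet> e \<and> u \<bullet> e \<le> y \<bullet> e) \<or>
      (\<forall>x\<in>\<sigma>. \<forall>y\<in>\<tau>. y \<bullet> e \<le> u \<bullet> e \<and> u \<bullet> e \<le> x \<bullet> e)"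
      using le ge nz by (cases "a \<bullet> e > 0") (auto simp: mult_le_cancel_left)
  qed
qed

text \<open>
  If \<open>\<rho>\<close> ends where \<open>\<sigma>\<close> begins and \<open>\<sigma>\<close> ends where \<open>\<tau>\<close> begins, then \<open>\<rho>\<close> and \<open>\<tau>\<close> can only touch if \<open>\<sigma>\<close> has
  length zero. The other orders of three segments are symmetric to this one or cyclic, which is
  impossible as well.
\<close>

lemma card_nearly_neighbourly_line_le:
  fixes F :: "'a::euclidean_space set set"
  assumes dim: "DIM('a) = 1"
    and simp: "\<And>\<sigma>. \<sigma> \<in> F \<Longrightarrow> 1 simplex \<sigma>"
    and nn: "nearly_neighbourly F"
  shows "card F \<le> 2"
proof (rule ccontr)
  assume "\<not> card F \<le> 2"
  then obtain G where "G \<subseteq> F" "card G = 3"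
    by (metis not_less_eq_eq numeral_2_eq_2 numeral_3_eq_3 obtain_subset_with_card_n)
  then obtain \<rho> \<sigma> \<tau> where mem: "\<rho> \<in> F" "\<sigma> \<in> F" "\<tau> \<in> F"
    and ne: "\<rho> \<noteq> \<sigma>" "\<sigma> \<noteq> \<tau>" "\<rho> \<noteq> \<tau>"
    by (auto simp: card_3_iff)
  obtain e :: 'a where e: "Basis = {e}"
    using dim by (auto simp: card_1_singleton_iff)
  have two: "\<exists>x\<in>s. \<exists>y\<in>s. x \<bullet> e < y \<bullet> e" if s: "s \<in> F" for s
  proof -
    obtain C where C: "card C = 2" "s = convex hull C"
      using simp[OF s] by (auto simp: simplex_def)
    then obtain x y where xy: "x \<in> s" "y \<in> s" "x \<noteq> y"
      by (metis card_2_iff hull_inc insertCI)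
    then have "x \<bullet> e \<noteq> y \<bullet> e"
      using euclidean_eqI[of x y] unfolding e by blast
    with xy show ?thesis
      by (meson linorder_neqE_linordered_idom)
  qed
  have sep: "facet_separated \<rho> \<sigma>" "facet_separated \<sigma> \<tau>" "facet_separated \<rho> \<tau>"
    using nn mem ne by (auto simp: nearly_neighbourly_def)
  obtain u where u: "u \<in> \<rho>" "u \<in> \<sigma>"
      "(\<forall>x\<in>\<rho>. \<forall>y\<in>\<sigma>. x \<bullet> e \<le> u \<bullet> e \<and> u \<bullet> e \<le> y \<bullet> e) \<or>
       (\<forall>x\<in>\<rho>. \<forall>y\<in>\<sigma>. y \<bullet> e \<le> u \<bullet> e \<and> u \<bullet> e \<le> x \<bullet> e)"
    using facet_separated_line[OF e sep(1)] by blast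
  obtain v where v: "v \<in> \<sigma>" "v \<in> \<tau>"
      "(\<forall>x\<in>\<sigma>. \<forall>y\<in>\<tau>. x \<bullet> e \<le> v \<bullet> e \<and> v \<bullet> e \<le> y \<bullet> e) \<or>
       (\<forall>x\<in>\<sigma>. \<forall>y\<in>\<tau>. y \<bullet> e \<le> v \<bullet> e \<and> v \<bullet> e \<le> x \<bullet> e)"
    using facet_separated_line[OF e sep(2)] by blast
  obtain w where w: "w \<in> \<rho>" "w \<in> \<tau>"
      "(\<forall>x\<in>\<rho>. \<forall>y\<in>\<tau>. x \<bullet> e \<le> w \<bullet> e \<and> w \<bullet> e \<le> y \<bullet> e) \<or>
       (\<forall>x\<in>\<rho>. \<forall>y\<in>\<tau>. y \<bullet> e \<le> w \<bullet> e \<and> w \<bullet> e \<le> x \<bullet> e)"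
    using facet_separated_line[OF e sep(3)] by blast
  obtain r r' s s' t t' where "r \<in> \<rho>" "r' \<in> \<rho>" "r \<bullet> e < r' \<bullet> e"
    "s \<in> \<sigma>" "s' \<in> \<sigma>" "s \<bullet> e < s' \<bullet> e" "t \<in> \<tau>" "t' \<in> \<tau>" "t \<bullet> e < t' \<bullet> e"
    using two[OF mem(1)] two[OF mem(2)] two[OF mem(3)] by blast
  with u v w show False
    by (smt (verit))
qed

text \<open>
  Every finite subfamily is again nearly neighbourly, so the uniform bound for finite families also
  yields finiteness.
\<close>

theorem corollary1:
  fixes F :: "(real ^ 'n) set set"
  assumes "\<And>\<sigma>. \<sigma> \<in> F \<Longrightarrow> int CARD('n) simplex \<sigma>"
    and "nearly_neighbourly F"
  shows "finite F \<and> card F \<le> 2 ^ (CARD('n) + 1) - 2"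
proof (rule finite_if_finite_subsets_card_bdd)
  fix G assume G: "G \<subseteq> F" "finite G"
  have nn: "nearly_neighbourly G"
    using assms(2) G(1) by (auto simp: nearly_neighbourly_def)
  have simp: "int CARD('n) simplex \<sigma>" if "\<sigma> \<in> G" for \<sigma>
    using assms(1) G(1) that by blast
  show "card G \<le> 2 ^ (CARD('n) + 1) - 2"
  proof (cases "CARD('n) = 1")
    case True
    then show ?thesis
      using card_nearly_neighbourly_line_le[of G] nn simp by simp
  next
    case False
    then have "CARD('n) \<ge> 2"
      using zero_less_card_finite[where 'a = 'n] by linarith
    then show ?thesis
      using card_nearly_neighbourly_le[of G] G(2) nn simp by simp
  qed
qed

end
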